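(* Let $\beta,\gamma,\delta$ be complex numbers with $\delta\ne0$ such that $\Re\left(\frac{\beta\gamma}{\delta}-\beta-\gamma+1\right)>0$, and such that $\beta+\gamma-\delta+1$ and $\frac{\beta\gamma}{\delta}$ are not non-positive integers. Then $$ {}_3F_2\!\left[\begin{matrix}\beta+\gamma-\delta,\ \beta,\ \gamma\\ \beta+\gamma-\delta+1,\ \frac{\beta\gamma}{\delta}\end{matrix};1\right]=\frac{\beta\gamma+\delta-\beta\delta-\gamma\delta+\delta^2}{\beta\gamma+\delta}\;{}_3F_2\!\left[\begin{matrix}\beta+\gamma-\delta,\ \beta+1,\ \gamma+1\\ \beta+\gamma-\delta+1,\ \frac{\beta\gamma}{\delta}+2\end{matrix};1\right]. $$
   Context: For complex $a,b,c$ and complex $d,e$ that are not non-positive integers, ${}_3F_2\!\left[\begin{matrix}a,b,c\\ d,e\end{matrix};1\right]=\sum_{k=0}^{\infty}\frac{(a)_k(b)_k(c)_k}{k!\,(d)_k(e)_k}$, where $(x)_0=1$ and $(x)_k=x(x+1)\cdots(x+k-1)$ for $k\ge1$; the series converges when $\Re(d+e)>\Re(a+b+c)$. *)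

theory Defs
  imports "HOL-Analysis.Analysis" "HOL-Library.Nonpos_Ints"
begin

(* The value at the argument 1. The numerator parameters are a, b, c and the denominator
   parameters are d, e. As usual for suminf, the value is meaningful only where the series
   converges; with d, e not in \<int>\<^sub>\<le>\<^sub>0 this is guaranteed by Re (d + e) > Re (a + b + c). *)
definition hyp3F2_at_1 :: "complex \<Rightarrow> complex \<Rightarrow> complex \<Rightarrow> complex \<Rightarrow> complex \<Rightarrow> complex" where
  "hyp3F2_at_1 a b c d e =
     (\<Sum>k. (pochhammer a k * pochhammer b k * pochhammer c k) /
           (fact k * pochhammer d k * pochhammer e k))"

end

(* Write a = \<beta> + \<gamma> - \<delta> and e = \<beta>\<gamma>/\<delta>. The choice of \<delta> makes the difference of the k-th
   terms of the two sides lose the pole of (a)_k / (a+1)_k = a / (a+k), after which it is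
   Gosper-summable: its partial sums up to n are a/(e+1) (\<beta>+1)_n (\<gamma>+1)_n / (n! (e+2)_n),
   which is O(n^{Re (\<beta>+\<gamma>-e-1)}) and hence tends to 0. *)
theory Submission
  imports Defs "HOL-Library.Landau_Symbols"
begin

text \<open>By definition \<open>rGamma_series z n\<close> is \<open>pochhammer z (n + 1)\<close>
  divided by \<open>fact n\<close> times n^z, and it tends to \<open>rGamma z\<close>. Rewriting all
  six factors this way, with \<open>fact (Suc n)\<close> read as
  \<open>pochhammer 1 (Suc n)\<close>, the factorials cancel three against three and only a bounded
  factor times n^(a+b+c-1-d-e) is left. This is also why the term is taken at
  \<open>Suc n\<close>.\<close>

lemma hyp3F2_term_Suc_bigo:
  fixes a b c d e :: complex
  assumes d: "d \<notin> \<int>\<^sub>\<le>\<^sub>0" and e: "e \<notin> \<int>\<^sub>\<le>\<^sub>0"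
  defines "f \<equiv> \<lambda>n::nat. pochhammer a n * pochhammer b n * pochhammer c n /
                    (fact n * pochhammer d n * pochhammer e n)"
  shows "(\<lambda>n. norm (f (Suc n))) \<in> O(\<lambda>n. real n powr Re (a + b + c - d - e - 1))"
proof -
  define r where "r = (\<lambda>n. rGamma_series a n * rGamma_series b n * rGamma_series c n /
                    (rGamma_series 1 n * rGamma_series d n * rGamma_series e n))"
  define s where "s = a + b + c - d - e - 1"
  have "r \<longlonglongrightarrow> rGamma a * rGamma b * rGamma c / (rGamma 1 * rGamma d * rGamma e)"
    unfolding r_def using d e by (intro tendsto_intros) (auto simp: rGamma_eq_zero_iff)
  hence "(\<lambda>n. norm (r n)) \<longlonglongrightarrow> norm (rGamma a * rGamma b * rGamma c / (rGamma 1 * rGamma d * rGamma e))"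
    by (rule tendsto_norm)
  hence r: "(\<lambda>n. norm (r n)) \<in> O(\<lambda>_. 1)"
    by (intro bigoI_tendsto) auto
  \<comment> \<open>Positivity of \<open>n\<close> matters: since \<open>ln 0 = 0\<close>, the
    exponential is 1 at \<open>n = 0\<close>, whereas \<open>0 powr x = 0\<close>.\<close>
  have eq: "norm (f (Suc n)) = norm (r n) * real n powr Re s" if n: "n > 0" for n
  proof -
    define L where "L = complex_of_real (ln (real n))"
    have nz: "pochhammer d (Suc n) \<noteq> 0" "pochhammer e (Suc n) \<noteq> 0"
      using d e by (auto dest: pochhammer_eq_0_imp_nonpos_Int)
    have exp_s: "exp (s * L) = exp (a * L) * exp (b * L) * exp (c * L) /
                   (exp L * exp (d * L) * exp (e * L))"
      by (simp add: s_def ring_distribs left_diff_distrib exp_add exp_diff)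
    have p1: "pochhammer 1 (Suc n) = (fact (Suc n) :: complex)"
      by (simp only: pochhammer_fact)
    have "f (Suc n) = r n * exp (s * L)"
      unfolding exp_s using nz
      by (simp add: f_def r_def rGamma_series_def p1 L_def[symmetric] mult.assoc del: fact_Suc)
    moreover have "norm (exp (s * L)) = real n powr Re s"
      using n by (simp add: L_def powr_def)
    ultimately show ?thesis by (simp add: norm_mult)
  qed
  have "(\<lambda>n. norm (r n) * real n powr Re s) \<in> O(\<lambda>n. 1 * real n powr Re s)"
    by (intro landau_o.big.mult r landau_o.big_refl)
  moreover have "eventually (\<lambda>n. norm (f (Suc n)) = norm (r n) * real n powr Re s) sequentially"
    using eventually_gt_at_top[of 0] by eventually_elim (rule eq)
  ultimately show ?thesis
    unfolding s_def by (subst landau_o.big.in_cong) auto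
qed

text \<open>The condition on the real parts puts the exponent of the preceding bound below
  -1.\<close>

lemma summable_hyp3F2_at_1:
  fixes a b c d e :: complex
  assumes "d \<notin> \<int>\<^sub>\<le>\<^sub>0" "e \<notin> \<int>\<^sub>\<le>\<^sub>0" "Re (a + b + c) < Re (d + e)"
  shows "summable (\<lambda>n. pochhammer a n * pochhammer b n * pochhammer c n /
                    (fact n * pochhammer d n * pochhammer e n))"
proof (subst summable_Suc_iff[symmetric], rule summable_norm_cancel,
       rule summable_comparison_test_bigo)
  show "summable (\<lambda>n. norm (real n powr Re (a + b + c - d - e - 1)))"
    using assms(3) by (simp add: summable_real_powr_iff)
qed (rule hyp3F2_term_Suc_bigo[OF assms(1,2)])

lemma hyp2F1_term_tendsto_0:
  fixes b c e :: complex
  assumes "e \<notin> \<int>\<^sub>\<le>\<^sub>0" "Re (b + c) < Re e + 1"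
  shows "(\<lambda>n. pochhammer b n * pochhammer c n / (fact n * pochhammer e n)) \<longlonglongrightarrow> 0"
proof -
  have "(\<lambda>n. norm (pochhammer b (Suc n) * pochhammer c (Suc n) /
               (fact (Suc n) * pochhammer e (Suc n))))
          \<in> O(\<lambda>n. real n powr Re (b + c - e - 1))"
    \<comment> \<open>The instantiation sets both \<open>d\<close> and \<open>a\<close> to 1, so
      that these two Pochhammer factors cancel and a 2F1 term remains.\<close>
    using hyp3F2_term_Suc_bigo[of 1 e 1 b c] assms(1)
    by (simp add: pochhammer_fact[symmetric] del: fact_Suc)
  also have "(\<lambda>n. real n powr Re (b + c - e - 1)) \<in> o(\<lambda>_. 1)"
  proof (rule smalloI_tendsto)
    show "(\<lambda>n. real n powr Re (b + c - e - 1) / 1) \<longlonglongrightarrow> 0"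
      using assms(2) by (auto intro!: tendsto_neg_powr filterlim_real_sequentially)
  qed auto
  finally have "(\<lambda>n. norm (pochhammer b (Suc n) * pochhammer c (Suc n) /
                      (fact (Suc n) * pochhammer e (Suc n)))) \<longlonglongrightarrow> 0"
    using smalloD_tendsto by fastforce
  hence "(\<lambda>n. pochhammer b (Suc n) * pochhammer c (Suc n) /
            (fact (Suc n) * pochhammer e (Suc n))) \<longlonglongrightarrow> 0"
    by (rule tendsto_norm_zero_cancel)
  thus ?thesis by (rule LIMSEQ_imp_Suc)
qed

text \<open>By induction, the summand at \<open>Suc n\<close> has to equal the increment of the
  right-hand side. Divided by the closed form at \<open>n\<close>, both are rational functions of
  the index, and their equality is the polynomial identity \<open>key\<close>.\<close>

lemma hyp3F2_difference_partial_sum: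
  fixes a b c \<delta> e :: complex
  assumes a: "a = b + c - \<delta>" and \<delta>: "\<delta> * e = b * c"
    and a1: "a + 1 \<notin> \<int>\<^sub>\<le>\<^sub>0" and e: "e \<notin> \<int>\<^sub>\<le>\<^sub>0"
  shows "(\<Sum>k\<le>n. pochhammer a k * pochhammer b k * pochhammer c k /
                   (fact k * pochhammer (a + 1) k * pochhammer e k) -
                 (e + 1 - a) / (e + 1) *
                   (pochhammer a k * pochhammer (b + 1) k * pochhammer (c + 1) k /
                   (fact k * pochhammer (a + 1) k * pochhammer (e + 2) k)))
         = a / (e + 1) * (pochhammer (b + 1) n * pochhammer (c + 1) n /
                           (fact n * pochhammer (e + 2) n))"
proof (induction n)
  have e1: "e + of_nat k \<noteq> 0" for k
    using e by (metis add_eq_0_iff2 minus_of_nat_in_nonpos_Ints)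
  have e_nz: "e \<noteq> 0" "e + 1 \<noteq> 0" using e1[of 0] e1[of 1] by auto
  {
    case 0
    show ?case using e_nz by (simp add: field_simps)
  next
    case (Suc n)
    \<comment> \<open>\<open>m\<close> is the index of the new summand, \<open>s\<close> the 2F1
      term at the old index, and \<open>r\<close> the factor with the pole. The facts below express
      everything at index \<open>m\<close> through these three.\<close>
    define m :: complex where "m = of_nat (Suc n)"
    define s where "s = pochhammer (b + 1) n * pochhammer (c + 1) n /
                          (fact n * pochhammer (e + 2) n)"
    define r where "r = pochhammer a (Suc n) / pochhammer (a + 1) (Suc n)"
    have "m \<noteq> 0"
      unfolding m_def of_nat_eq_0_iff by simp
    moreover have "e + m \<noteq> 0" "e + 1 + m \<noteq> 0"
      using e1[of "Suc n"] e1[of "Suc (Suc n)"] by (simp_all add: m_def add_ac)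
    ultimately have nz: "m \<noteq> 0" "e + m \<noteq> 0" "e + 1 + m \<noteq> 0"
      by auto
    have "pochhammer (a + 1) (Suc n) \<noteq> 0"
      using a1 by (auto dest: pochhammer_eq_0_imp_nonpos_Int)
    moreover have "(a + m) * pochhammer a (Suc n) = a * pochhammer (a + 1) (Suc n)"
      by (metis m_def pochhammer_rec pochhammer_rec')
    \<comment> \<open>This is r = a/(a+m) without division, so that \<open>algebra\<close> can use
      it.\<close>
    ultimately have r: "(a + m) * r = a"
      by (simp add: r_def field_simps)
    have "pochhammer e (Suc n) * (e + m) = e * (e + 1) * pochhammer (e + 2) n"
    proof -
      have "pochhammer e (Suc n) * (e + m) = pochhammer e (Suc (Suc n))"
        by (simp only: pochhammer_rec'[of e "Suc n"] m_def mult.commute)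
      also have "\<dots> = e * (e + 1) * pochhammer (e + 2) n"
        by (simp add: pochhammer_rec[of e] pochhammer_rec[of "e + 1"] add.assoc del: pochhammer_Suc)
      finally show ?thesis .
    qed
    hence pe: "pochhammer e (Suc n) = e * (e + 1) * pochhammer (e + 2) n / (e + m)"
      using nz by (simp add: field_simps)
    have fact: "fact (Suc n) = m * (fact n :: complex)"
      by (simp add: m_def)
    \<comment> \<open>Writing the leading factor \<open>b * c\<close> as \<open>\<delta> * e\<close>
      lets its \<open>e\<close> cancel against the one in \<open>pe\<close>.\<close>
    have pbc: "pochhammer b (Suc n) * pochhammer c (Suc n) =
                 \<delta> * e * (pochhammer (b + 1) n * pochhammer (c + 1) n)"
      unfolding \<delta> by (simp add: pochhammer_rec mult_ac)
    have t: "pochhammer b (Suc n) * pochhammer c (Suc n) / (fact (Suc n) * pochhammer e (Suc n))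
              = \<delta> * s * (e + m) / (m * (e + 1))"
      unfolding pe fact pbc s_def using e_nz by (simp add: mult_ac)
    have p1: "pochhammer (x + 1) (Suc n) = pochhammer (x + 1) n * (x + m)" for x
      by (simp add: pochhammer_Suc m_def add_ac)
    have p2: "pochhammer (e + 2) (Suc n) = pochhammer (e + 2) n * (e + 1 + m)"
      by (simp add: pochhammer_Suc m_def add_ac)
    have s': "pochhammer (b + 1) (Suc n) * pochhammer (c + 1) (Suc n) /
               (fact (Suc n) * pochhammer (e + 2) (Suc n)) =
             s * ((b + m) * (c + m) / (m * (e + 1 + m)))"
      unfolding p1 p2 fact s_def by (simp add: mult_ac)
    \<comment> \<open>The bracket on the left is a polynomial in \<open>m\<close> with root -a:
      there (b+m)(c+m) becomes (\<delta>-c)(\<delta>-b), which is \<delta>(e-a) because bc =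
      \<delta>e. The factor a+m thus splits off and absorbs the pole of \<open>r\<close>. The
      cofactor is the numerator of the increment, as consecutive 2F1 terms have ratio
      (b+m)(c+m)/(m(e+1+m)).\<close>
    have key: "r * (\<delta> * (e + m) * (e + 1 + m) - (e + 1 - a) * (b + m) * (c + m)) =
               a * ((b + m) * (c + m) - m * (e + 1 + m))"
    proof -
      have "\<delta> * (e + m) * (e + 1 + m) - (e + 1 - a) * (b + m) * (c + m) =
            (a + m) * ((b + m) * (c + m) - m * (e + 1 + m))"
        using a \<delta> by algebra
      thus ?thesis using r by algebra
    qed
    have "r * (\<delta> * s * (e + m) / (m * (e + 1))) -
            (e + 1 - a) / (e + 1) * (r * (s * ((b + m) * (c + m) / (m * (e + 1 + m))))) =
          s / (m * (e + 1) * (e + 1 + m)) *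
            (r * (\<delta> * (e + m) * (e + 1 + m) - (e + 1 - a) * (b + m) * (c + m)))"
      using nz e_nz by (simp add: divide_simps) algebra
    also have "\<dots> = a / (e + 1) * (s * ((b + m) * (c + m) / (m * (e + 1 + m)))) - a / (e + 1) * s"
      unfolding key using nz e_nz by (simp add: divide_simps) algebra
    finally have step: "r * (\<delta> * s * (e + m) / (m * (e + 1))) -
            (e + 1 - a) / (e + 1) * (r * (s * ((b + m) * (c + m) / (m * (e + 1 + m))))) =
          a / (e + 1) * (s * ((b + m) * (c + m) / (m * (e + 1 + m)))) - a / (e + 1) * s" .
    \<comment> \<open>Stated for arbitrary \<open>x y z w\<close> so that it extracts
      \<open>r\<close> from the summands of both series.\<close>
    have split: "pochhammer a (Suc n) * x * y / (z * pochhammer (a + 1) (Suc n) * w) = r * (x * y / (z * w))"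
      for x y z w by (simp add: r_def mult_ac)
    show ?case
      unfolding sum.atMost_Suc Suc.IH split t s' step s_def[symmetric] by simp
  }
qed

theorem theorem9:
  fixes \<beta> \<gamma> \<delta> :: complex
  assumes "\<delta> \<noteq> 0"
    and "Re (\<beta> * \<gamma> / \<delta> - \<beta> - \<gamma> + 1) > 0"
    and "\<beta> + \<gamma> - \<delta> + 1 \<notin> \<int>\<^sub>\<le>\<^sub>0"
    and "\<beta> * \<gamma> / \<delta> \<notin> \<int>\<^sub>\<le>\<^sub>0"
  shows "hyp3F2_at_1 (\<beta> + \<gamma> - \<delta>) \<beta> \<gamma> (\<beta> + \<gamma> - \<delta> + 1) (\<beta> * \<gamma> / \<delta>) =
           (\<beta> * \<gamma> + \<delta> - \<beta> * \<delta> - \<gamma> * \<delta> + \<delta>\<^sup>2) / (\<beta> * \<gamma> + \<delta>) *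
           hyp3F2_at_1 (\<beta> + \<gamma> - \<delta>) (\<beta> + 1) (\<gamma> + 1) (\<beta> + \<gamma> - \<delta> + 1) (\<beta> * \<gamma> / \<delta> + 2)"
proof -
  define a where "a = \<beta> + \<gamma> - \<delta>"
  define e where "e = \<beta> * \<gamma> / \<delta>"
  define K where "K = (e + 1 - a) / (e + 1)"
  define f where "f = (\<lambda>k. pochhammer a k * pochhammer \<beta> k * pochhammer \<gamma> k /
                   (fact k * pochhammer (a + 1) k * pochhammer e k))"
  define g where "g = (\<lambda>k. pochhammer a k * pochhammer (\<beta> + 1) k * pochhammer (\<gamma> + 1) k /
                   (fact k * pochhammer (a + 1) k * pochhammer (e + 2) k))"
  have a1: "a + 1 \<notin> \<int>\<^sub>\<le>\<^sub>0" and e: "e \<notin> \<int>\<^sub>\<le>\<^sub>0"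
    using assms(3,4) by (simp_all add: a_def e_def)
  have e2: "e + 2 \<notin> \<int>\<^sub>\<le>\<^sub>0"
    using e nonpos_Ints_diff_Nats[of "e + 2" 2] by auto
  have \<delta>: "\<delta> * e = \<beta> * \<gamma>" using assms(1) by (simp add: e_def)
  have re: "Re (\<beta> + \<gamma>) < Re e + 1"
    using assms(2) by (simp add: e_def[symmetric])
  \<comment> \<open>For both series the convergence condition reduces to \<open>re\<close>: the
    shifts by 1 in two numerator parameters balance the shift by 2 in the denominator.\<close>
  have f: "summable f" and g: "summable g"
    unfolding f_def g_def using a1 e e2 re by (auto intro!: summable_hyp3F2_at_1)
  have "(\<lambda>n. \<Sum>k\<le>n. f k - K * g k) \<longlonglongrightarrow> a / (e + 1) * 0"
    unfolding f_def g_def K_def hyp3F2_difference_partial_sum[OF a_def \<delta> a1 e]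
    using e2 re by (intro tendsto_mult tendsto_const hyp2F1_term_tendsto_0) auto
  hence "(\<lambda>k. f k - K * g k) sums 0"
    by (simp add: sums_def_le)
  moreover have "(\<lambda>k. f k - K * g k) sums (suminf f - K * suminf g)"
    using f g by (intro sums_diff sums_mult summable_sums)
  ultimately have "suminf f = K * suminf g"
    using sums_unique2 by fastforce
  moreover have "K = (\<beta> * \<gamma> + \<delta> - \<beta> * \<delta> - \<gamma> * \<delta> + \<delta>\<^sup>2) / (\<beta> * \<gamma> + \<delta>)"
  proof -
    \<comment> \<open>Expanding the fraction by \<open>\<delta>\<close> turns each
      \<open>\<delta> * e\<close> into \<open>\<beta> * \<gamma>\<close> and gives the stated
      prefactor.\<close>
    have "K = (\<delta> * (e + 1 - a)) / (\<delta> * (e + 1))"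
      using assms(1) by (simp add: K_def)
    also have "\<delta> * (e + 1 - a) = \<beta> * \<gamma> + \<delta> - \<beta> * \<delta> - \<gamma> * \<delta> + \<delta>\<^sup>2"
      using \<delta> by (simp add: a_def power2_eq_square algebra_simps)
    also have "\<delta> * (e + 1) = \<beta> * \<gamma> + \<delta>"
      using \<delta> by (simp add: algebra_simps)
    finally show ?thesis .
  qed
  ultimately show ?thesis
    by (simp add: hyp3F2_at_1_def f_def g_def a_def e_def)
qed

end
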